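(* Consider the canonical negative-positive double Boolean automata circuit $D_{\ell,r}$ (negative left-circuit of size $\ell$, positive right-circuit of size $r$). Let $\phi=\frac{1+\sqrt5}{2}$ and $\overline\phi=\frac{1-\sqrt5}{2}$. Let $\Delta_p=\gcd(\ell,p)$ where $p$ is a divisor of $r$ that does not divide $\ell$. Then the number $C_{p,\Delta_p}$ of configurations of period $p$ is given by $$C_{p,\Delta_p}=\begin{cases}|\overline\phi|^{p}\cdot\left((\phi^2)^{\frac p{\Delta_p}}-1\right)^{\Delta_p} & \text{if } \frac p{\Delta_p} \text{ is odd},\\[4pt] |\overline\phi|^{p}\cdot\left((\phi^2)^{\frac p{\Delta_p}}+1\right)^{\Delta_p} & \text{if } \frac p{\Delta_p}\text{ is even}.\end{cases}$$ In particular, $C_{r,\gcd(\ell,r)}$ counts the total number of periodic configurations of the network. The number of attractors of period $p$ (which depends only on $p$ and $\Delta_p$, and is also written $\mathtt{A}^{\pm}_{p,\Delta_p}$) and the total number of attractors are respectively given by $$\mathtt{A}^{\pm}_p(\ell,r)=\mathtt{A}^{\pm}_{p,\Delta_p}=\frac1p\sum_{q\mid p}\mu\!\left(\frac pq\right) C_{q,\Delta_q} \qquad\text{and}\qquad \mathtt{T}^{\pm}(\ell,r)=\frac1r\sum_{p\mid r,\ \neg(p\mid \ell)}\psi\!\left(\frac rp\right) C_{p,\Delta_p}.$$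
   Context: The canonical negative-positive double Boolean automata circuit $D_{\ell,r}$ has $n=\ell+r-1$ nodes $0,\ldots,n-1$. For a configuration $x=(x_0,\ldots,x_{n-1})\in\{0,1\}^n$ write $x^L=(x_0,\ldots,x_{\ell-1})$ (states of the left-circuit) and $x^R=(x_0,x_\ell,\ldots,x_{n-1})$ (states of the right-circuit, $r$ entries). All nodes are updated in parallel by $F:\{0,1\}^n\to\{0,1\}^n$: $F(x)_i=x_{i-1}$ for $i\notin\{0,\ell\}$; $F(x)_\ell=x_0$; and $F(x)_0=\neg a\vee b$, where $a=x_{\ell-1}$ is the last entry of $x^L$ and $b$ is the last entry of $x^R$. A configuration $x$ has period $p$ if $F^{p}(x)=x$ ($p$ need not be minimal); it has exact period $p$ if moreover it has no period $d<p$; it is periodic if it has some period $p\ge1$. An attractor of period $p$ is the orbit under $F$ of a configuration of exact period $p$ (fixed points are the attractors of period $1$). The total number of attractors $\mathtt{T}^{\pm}(\ell,r)$ counts attractors of all periods. For a positive integer $m$, $\Delta_m=\gcd(\ell,m)$, and $C_{m,\Delta_m}$ denotes the number of configurations of period $m$ (the notation reflects that this number depends only on $m$ and $\Delta_m$). $\mu$ is the Möbius function and $\psi$ is Euler's totient function.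
   Formalization: The last sum, for the total number of attractors, runs over all divisors p of r instead of only those not dividing ℓ; the printed formula is false (ℓ=1, r=2 gives 3/2, but there are 2 attractors) since it omits terms coming from the all-ones fixed point. *)

theory Defs
  imports
    Complex_Main
    "HOL-Computational_Algebra.Squarefree"
    "HOL-Number_Theory.Totient"
begin

definition configs :: "nat \<Rightarrow> nat \<Rightarrow> bool list set" where
  "configs l r = {x. length x = l + r - 1}"

(* Node 0 belongs to both circuits; for r = 1 the right circuit is node 0 alone
   and there is no node l. *)
definition left_part :: "nat \<Rightarrow> bool list \<Rightarrow> bool list" where
  "left_part l x = take l x"

definition right_part :: "nat \<Rightarrow> bool list \<Rightarrow> bool list" where
  "right_part l x = x ! 0 # drop l x"

definition F :: "nat \<Rightarrow> nat \<Rightarrow> bool list \<Rightarrow> bool list" where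
  "F l r x =
     map (\<lambda>i. if i = 0 then \<not> last (left_part l x) \<or> last (right_part l x)
              else if i = l then x ! 0
              else x ! (i - 1))
       [0..<l + r - 1]"

definition has_period :: "nat \<Rightarrow> nat \<Rightarrow> nat \<Rightarrow> bool list \<Rightarrow> bool" where
  "has_period l r p x \<longleftrightarrow> p \<ge> 1 \<and> (F l r ^^ p) x = x"

definition has_exact_period :: "nat \<Rightarrow> nat \<Rightarrow> nat \<Rightarrow> bool list \<Rightarrow> bool" where
  "has_exact_period l r p x \<longleftrightarrow>
     has_period l r p x \<and> (\<forall>d<p. \<not> has_period l r d x)"

definition periodic_configs :: "nat \<Rightarrow> nat \<Rightarrow> bool list set" where
  "periodic_configs l r = {x \<in> configs l r. \<exists>p. has_period l r p x}"

definition attractors_of_period :: "nat \<Rightarrow> nat \<Rightarrow> nat \<Rightarrow> bool list set set" where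
  "attractors_of_period l r p =
     (\<lambda>x. range (\<lambda>t. (F l r ^^ t) x)) ` {x \<in> configs l r. has_exact_period l r p x}"

definition num_configs :: "nat \<Rightarrow> nat \<Rightarrow> nat \<Rightarrow> nat" where
  "num_configs l r m = card {x \<in> configs l r. has_period l r m x}"

definition num_attractors :: "nat \<Rightarrow> nat \<Rightarrow> nat \<Rightarrow> nat" where
  "num_attractors l r p = card (attractors_of_period l r p)"

(* The all-ones configuration is a fixed point and the only configuration whose period
   divides both l and r. It counts here as an attractor, so a formula for the total in terms
   of the numbers num_configs l r p has to include the divisors p of r that divide l. *)
definition total_attractors :: "nat \<Rightarrow> nat \<Rightarrow> nat" where
  "total_attractors l r = card (\<Union>p. attractors_of_period l r p)"

definition moebius :: "nat \<Rightarrow> int" where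
  "moebius n = (if squarefree n then (-1) ^ card (prime_factors n) else 0)"

definition phi :: real where
  "phi = (1 + sqrt 5) / 2"

definition phi_conj :: real where
  "phi_conj = (1 - sqrt 5) / 2"

end

theory Submission
  imports Defs "HOL-Library.FuncSet" "HOL-Number_Theory.Fib"
begin

text \<open>
  The states \<open>u t\<close> of node 0 along a trajectory satisfy \<open>u t \<longleftrightarrow> \<not> u (t - l) \<or> u (t - r)\<close>. On a
  periodic trajectory \<open>u\<close> never drops along steps of length \<open>r\<close>, so it is constant along them;
  hence \<open>r\<close> is a period, and the equation reduces to \<open>u t \<or> u (t - l)\<close>. For \<open>p dvd r\<close> the
  configurations of period \<open>p\<close> thus correspond, through the zeros of \<open>u\<close>, to the subsets
  of \<open>\<int>/p\<close> without two elements at distance \<open>l\<close>. Steps of length \<open>l\<close> split \<open>\<int>/p\<close> into \<open>gcd l p\<close> cycles of length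
  \<open>m = p div gcd l p\<close>, and each cycle contributes the Lucas number
  \<open>fib (m + 1) + fib (m - 1) = phi ^ m + phi_conj ^ m\<close>. Moebius inversion gives the numbers of
  configurations of exact period \<open>p\<close>, and the totient identity sums them up.
\<close>

subsection \<open>Sums over divisors\<close>

text \<open>Exchange the two sums. For fixed \<open>d\<close>, the map sending \<open>q\<close> to
  \<open>n div q\<close> carries the \<open>q\<close> with \<open>d dvd q\<close> and
  \<open>q dvd n\<close> bijectively onto the divisors of \<open>n div d\<close>. Taking
  \<open>g\<close> to be \<open>moebius\<close> gives inversion; taking it to be
  \<open>totient\<close> gives the count of all attractors.\<close>

lemma sum_divisors_convolution:
  fixes g h :: "nat \<Rightarrow> 'a::comm_semiring_0"
  assumes "n > 0"
  shows "(\<Sum>q | q dvd n. g (n div q) * (\<Sum>d | d dvd q. h d)) =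
         (\<Sum>d | d dvd n. h d * (\<Sum>e | e dvd n div d. g e))"
proof -
  have fin: "finite {d. d dvd n}" using assms by simp
  have "(\<Sum>q | q dvd n. g (n div q) * (\<Sum>d | d dvd q. h d)) =
        (\<Sum>q\<in>{q. q dvd n}. \<Sum>d | d \<in> {d. d dvd n} \<and> d dvd q. g (n div q) * h d)"
    unfolding sum_distrib_left
    by (intro sum.cong refl) (auto intro: dvd_trans)
  also have "\<dots> = (\<Sum>d\<in>{d. d dvd n}. \<Sum>q | q \<in> {q. q dvd n} \<and> d dvd q. g (n div q) * h d)"
    by (rule sum.swap_restrict[OF fin fin])
  also have "\<dots> = (\<Sum>d | d dvd n. h d * (\<Sum>e | e dvd n div d. g e))"
  proof (intro sum.cong refl)
    fix d assume "d \<in> {d. d dvd n}"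
    then have d: "d dvd n" by simp
    have "(\<Sum>q | q \<in> {q. q dvd n} \<and> d dvd q. g (n div q)) = (\<Sum>e | e dvd n div d. g e)"
    proof (rule sum.reindex_bij_witness[where i = "\<lambda>e. n div e" and j = "\<lambda>q. n div q"])
      fix q assume q: "q \<in> {q. q \<in> {q. q dvd n} \<and> d dvd q}"
      show "n div (n div q) = q" using q assms by (auto elim!: dvdE)
      show "n div q \<in> {e. e dvd n div d}" using q assms by (auto elim!: dvdE)
    next
      fix e assume e: "e \<in> {e. e dvd n div d}"
      moreover obtain c where "n = d * c" using d by blast
      ultimately obtain k where k: "n = d * (e * k)" using assms by auto
      show "n div (n div e) = e" "n div e \<in> {q. q \<in> {q. q dvd n} \<and> d dvd q}"
        using assms by (auto simp: k)
    qed simp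
    then show "(\<Sum>q | q \<in> {q. q dvd n} \<and> d dvd q. g (n div q) * h d) =
          h d * (\<Sum>e | e dvd n div d. g e)"
      by (simp add: sum_distrib_left[symmetric] mult.commute)
  qed
  finally show ?thesis .
qed

section \<open>The Moebius function and inversion\<close>

lemma moebius_mult_prime:
  assumes "prime p" "\<not> p dvd d" "d > 0"
  shows "moebius (p * d) = - moebius d"
proof -
  have cop: "coprime p d" using assms by (simp add: prime_imp_coprime)
  have "squarefree (p * d) \<longleftrightarrow> squarefree d"
    using squarefree_mult_coprime[OF cop] squarefree_prime[OF assms(1)] squarefree_multD(2) by blast
  moreover have "prime_factors (p * d) = insert p (prime_factors d)"
    using assms by (subst prime_factors_product) (auto simp: prime_factorization_prime)
  moreover have "p \<notin> prime_factors d" using assms by auto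
  ultimately show ?thesis by (simp add: moebius_def)
qed

text \<open>Fix a prime \<open>p\<close> dividing \<open>n\<close>. Only squarefree divisors
  contribute, and multiplication by \<open>p\<close> pairs those prime to \<open>p\<close> with
  those divisible by \<open>p\<close>. By \<open>moebius_mult_prime\<close> the two members of a
  pair cancel.\<close>

lemma sum_moebius_divisors:
  assumes "n > 0"
  shows "(\<Sum>d | d dvd n. moebius d) = (if n = 1 then 1 else 0)"
proof (cases "n = 1")
  case True
  then show ?thesis by (simp add: moebius_def)
next
  case False
  then obtain p where p: "prime p" "p dvd n" using prime_factor_nat by blast
  let ?S = "{d. d dvd n \<and> squarefree d}"
  let ?A = "{d \<in> ?S. \<not> p dvd d}"
  have fin: "finite ?S" using assms by simp
  have inj: "inj_on ((*) p) ?A" using p by (auto simp: inj_on_def)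
  have split: "?S = ?A \<union> (*) p ` ?A"
  proof (intro equalityI subsetI)
    fix d assume d: "d \<in> ?S"
    show "d \<in> ?A \<union> (*) p ` ?A"
    proof (cases "p dvd d")
      case True
      then obtain k where k: "d = p * k" by blast
      have "\<not> p dvd k"
      proof
        assume "p dvd k"
        then have "p\<^sup>2 dvd d" by (simp add: k power2_eq_square)
        with d have "is_unit p" by (auto simp: squarefree_def)
        with p show False by simp
      qed
      moreover have "k \<in> ?S" using d k by (auto dest: squarefree_multD dvd_mult_right)
      ultimately show ?thesis using k by blast
    qed (use d in auto)
  next
    fix d assume "d \<in> ?A \<union> (*) p ` ?A"
    moreover have "p * k \<in> ?S" if k: "k \<in> ?A" for k
    proof -
      have "coprime p k" using p k by (simp add: prime_imp_coprime)
      then show ?thesis using p k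
        by (auto intro: squarefree_mult_coprime squarefree_prime divides_mult)
    qed
    ultimately show "d \<in> ?S" by auto
  qed
  have "(\<Sum>d | d dvd n. moebius d) = (\<Sum>d\<in>?S. moebius d)"
    using assms by (intro sum.mono_neutral_right) (auto simp: moebius_def)
  also have "\<dots> = (\<Sum>d\<in>?A. moebius d) + (\<Sum>d\<in>(*) p ` ?A. moebius d)"
    by (subst split, rule sum.union_disjoint) (use finite_subset[OF _ fin, of ?A] in auto)
  also have "(\<Sum>d\<in>(*) p ` ?A. moebius d) = (\<Sum>d\<in>?A. moebius (p * d))"
    using inj by (simp add: sum.reindex)
  also have "\<dots> = (\<Sum>d\<in>?A. - moebius d)"
    using p assms by (intro sum.cong refl moebius_mult_prime) (auto dest: dvd_pos_nat)
  finally show ?thesis using False by (simp add: sum_negf)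
qed

text \<open>After the exchange of sums the coefficient of \<open>h d\<close> is the sum of
  \<open>moebius\<close> over the divisors of \<open>n div d\<close>, which vanishes unless
  \<open>d = n\<close>.\<close>

lemma moebius_inversion:
  fixes h :: "nat \<Rightarrow> 'a::comm_ring_1"
  assumes "n > 0"
  shows "(\<Sum>q | q dvd n. of_int (moebius (n div q)) * (\<Sum>d | d dvd q. h d)) = h n"
proof -
  have "(\<Sum>q | q dvd n. of_int (moebius (n div q)) * (\<Sum>d | d dvd q. h d)) =
        (\<Sum>d | d dvd n. h d * (\<Sum>e | e dvd n div d. of_int (moebius e)))"
    by (rule sum_divisors_convolution[OF assms, where g = "\<lambda>k. of_int (moebius k)"])
  also have "\<dots> = (\<Sum>d | d dvd n. if d = n then h n else 0)"
  proof (intro sum.cong refl)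
    fix d assume "d \<in> {d. d dvd n}"
    then obtain k where k: "n = d * k" by blast
    have "(\<Sum>e | e dvd n div d. of_int (moebius e)) = (of_int (if n div d = 1 then 1 else 0) :: 'a)"
      using assms k by (subst sum_moebius_divisors[symmetric]) auto
    then show "h d * (\<Sum>e | e dvd n div d. of_int (moebius e)) = (if d = n then h n else 0)"
      using assms k by auto
  qed
  also have "\<dots> = h n" using assms by simp
  finally show ?thesis .
qed

subsection \<open>Orbits and exact periods\<close>

definition exact_configs :: "nat \<Rightarrow> nat \<Rightarrow> nat \<Rightarrow> bool list set" where
  "exact_configs l r p = {x \<in> configs l r. has_exact_period l r p x}"

definition orbit :: "nat \<Rightarrow> nat \<Rightarrow> bool list \<Rightarrow> bool list set" where
  "orbit l r x = range (\<lambda>t. (F l r ^^ t) x)"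

lemma attractors_of_period_eq: "attractors_of_period l r p = orbit l r ` exact_configs l r p"
  by (simp add: attractors_of_period_def orbit_def exact_configs_def)

lemma finite_configs: "finite (configs l r)"
proof -
  have "configs l r = {x. set x \<subseteq> UNIV \<and> length x = l + r - 1}" by (auto simp: configs_def)
  then show ?thesis using finite_lists_length_eq[of "UNIV :: bool set"] by simp
qed

lemma F_in_configs: "F l r x \<in> configs l r"
  by (simp add: F_def configs_def)

lemma funpow_F_in_configs: "x \<in> configs l r \<Longrightarrow> (F l r ^^ t) x \<in> configs l r"
  by (cases t) (simp_all add: F_in_configs)

lemma has_period_iff_dvd:
  assumes "has_exact_period l r d x"
  shows "has_period l r m x \<longleftrightarrow> m \<ge> 1 \<and> d dvd m"
proof -
  have d: "(F l r ^^ d) x = x" "d \<ge> 1"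
    using assms by (auto simp: has_exact_period_def has_period_def)
  have eq: "(F l r ^^ (m mod d)) x = (F l r ^^ m) x" by (rule funpow_mod_eq[OF d(1)])
  show ?thesis
  proof (intro iffI conjI)
    assume m: "has_period l r m x"
    then show "m \<ge> 1" by (simp add: has_period_def)
    have "m mod d < d" using d by simp
    then have "\<not> has_period l r (m mod d) x" using assms by (simp add: has_exact_period_def)
    \<comment> \<open>A positive remainder would be a period below \<open>d\<close>. Remainder 0 is
      the only escape, because \<open>has_period\<close> demands at least 1.\<close>
    then have "m mod d = 0" using m eq by (auto simp: has_period_def Suc_le_eq)
    then show "d dvd m" by blast
  next
    assume "m \<ge> 1 \<and> d dvd m"
    then show "has_period l r m x" using eq by (simp add: has_period_def)
  qed
qed

lemma exact_period_unique:
  "has_exact_period l r d x \<Longrightarrow> has_exact_period l r e x \<Longrightarrow> d = e"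
  unfolding has_exact_period_def by (meson linorder_neqE_nat)

lemma has_exact_period_exists:
  "has_period l r p x \<Longrightarrow> \<exists>d. has_exact_period l r d x"
  unfolding has_exact_period_def by (meson LeastI not_less_Least)

lemma has_exact_period_funpow:
  assumes "has_exact_period l r p x"
  shows "has_exact_period l r p ((F l r ^^ t) x)"
proof -
  have p: "p \<ge> 1" "(F l r ^^ p) x = x"
    using assms by (auto simp: has_exact_period_def has_period_def)
  \<comment> \<open>The shift by \<open>t\<close> can be undone by going on to time
    \<open>p * t\<close>, a multiple of the period. Hence \<open>x\<close> and its image have the
    same periods.\<close>
  have ret: "(F l r ^^ (p * t - t)) ((F l r ^^ t) x) = x"
  proof -
    have "(F l r ^^ (p * t - t + t)) x = x"
      using p funpow_mod_eq[OF p(2), of "p * t"] by simp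
    then show ?thesis by (simp add: funpow_add)
  qed
  have "has_period l r m ((F l r ^^ t) x) = has_period l r m x" for m
  proof -
    have comm: "(F l r ^^ m) ((F l r ^^ k) y) = (F l r ^^ k) ((F l r ^^ m) y)" for k y
      by (metis add.commute comp_apply funpow_add)
    show ?thesis unfolding has_period_def by (metis ret comm)
  qed
  then show ?thesis using assms by (simp add: has_exact_period_def)
qed

lemma funpow_funpow: "(f ^^ i) ((f ^^ j) x) = (f ^^ (i + j)) x"
  by (simp add: funpow_add)

lemma self_in_orbit: "x \<in> orbit l r x"
  unfolding orbit_def by (rule range_eqI[of _ _ 0]) simp

lemma orbit_subset_exact_configs:
  "x \<in> exact_configs l r p \<Longrightarrow> orbit l r x \<subseteq> exact_configs l r p"
  by (auto simp: orbit_def exact_configs_def funpow_F_in_configs has_exact_period_funpow)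

lemma card_orbit:
  assumes "has_exact_period l r p x"
  shows "card (orbit l r x) = p"
proof -
  have p: "p \<ge> 1" "(F l r ^^ p) x = x"
    using assms by (auto simp: has_exact_period_def has_period_def)
  have "orbit l r x = (\<lambda>t. (F l r ^^ t) x) ` {..<p}"
  proof -
    have "(F l r ^^ t) x \<in> (\<lambda>t. (F l r ^^ t) x) ` {..<p}" for t
      using funpow_mod_eq[OF p(2), of t] p(1) by (intro image_eqI[of _ _ "t mod p"]) auto
    then show ?thesis by (auto simp: orbit_def)
  qed
  moreover have "inj_on (\<lambda>t. (F l r ^^ t) x) {..<p}"
  proof (rule linorder_inj_onI)
    fix i j assume ij: "i < j" "i \<in> {..<p}" "j \<in> {..<p}"
    show "(F l r ^^ i) x \<noteq> (F l r ^^ j) x"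
    proof
      assume "(F l r ^^ i) x = (F l r ^^ j) x"
      \<comment> \<open>A collision inside the first \<open>p\<close> states would give the
        \<open>i\<close>-th state a period below \<open>p\<close>.\<close>
      then have "has_period l r (j - i) ((F l r ^^ i) x)"
        using ij funpow_funpow[of "j - i" "F l r" i x] by (simp add: has_period_def)
      then show False
        using has_exact_period_funpow[OF assms, of i] ij by (auto simp: has_exact_period_def)
    qed
  qed auto
  ultimately show ?thesis by (simp add: card_image)
qed

text \<open>The orbit of \<open>y\<close> is contained in that of \<open>x\<close>, and both have
  exactly \<open>p\<close> elements, so they coincide.\<close>

lemma orbit_eq:
  assumes "has_exact_period l r p x" "y \<in> orbit l r x"
  shows "orbit l r y = orbit l r x"
proof (rule card_subset_eq)
  obtain t where t: "y = (F l r ^^ t) x" using assms(2) by (auto simp: orbit_def)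
  show "orbit l r y \<subseteq> orbit l r x"
    by (auto simp: t orbit_def funpow_funpow)
  show "card (orbit l r y) = card (orbit l r x)"
    using card_orbit[OF assms(1)] card_orbit[OF has_exact_period_funpow[OF assms(1)]] t by simp
  show "finite (orbit l r x)"
    using card_orbit[OF assms(1)] assms(1)
    by (intro card_ge_0_finite) (auto simp: has_exact_period_def has_period_def)
qed

section \<open>Counting attractors by exact periods\<close>

lemma finite_exact_configs: "finite (exact_configs l r p)"
  by (simp add: exact_configs_def finite_configs)

text \<open>The orbits partition the configurations of exact period \<open>p\<close> into blocks of
  size \<open>p\<close>.\<close>

lemma num_attractors_mult_period: "p * num_attractors l r p = card (exact_configs l r p)"
proof -
  have Un: "\<Union> (orbit l r ` exact_configs l r p) = exact_configs l r p"
    by (intro equalityI UN_least orbit_subset_exact_configs) (auto intro: self_in_orbit)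
  have "p * card (orbit l r ` exact_configs l r p) = card (\<Union> (orbit l r ` exact_configs l r p))"
  proof (rule card_partition)
    fix c assume "c \<in> orbit l r ` exact_configs l r p"
    then show "card c = p" by (auto simp: exact_configs_def card_orbit)
  next
    fix c1 c2
    assume "c1 \<in> orbit l r ` exact_configs l r p" "c2 \<in> orbit l r ` exact_configs l r p" "c1 \<noteq> c2"
    then show "c1 \<inter> c2 = {}" by (auto simp: exact_configs_def dest: orbit_eq)
  qed (simp_all only: Un finite_exact_configs finite_imageI)
  then show ?thesis by (simp only: num_attractors_def attractors_of_period_eq Un)
qed

lemma num_configs_eq_sum_exact:
  assumes "q \<ge> 1"
  shows "num_configs l r q = (\<Sum>d | d dvd q. card (exact_configs l r d))"
proof -
  have "{x \<in> configs l r. has_period l r q x} = (\<Union>d\<in>{d. d dvd q}. exact_configs l r d)"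
    using assms has_period_iff_dvd has_exact_period_exists
    by (fastforce simp: exact_configs_def)
  moreover have "card (\<Union>d\<in>{d. d dvd q}. exact_configs l r d) =
      (\<Sum>d\<in>{d. d dvd q}. card (exact_configs l r d))"
    using assms by (intro card_UN_disjoint)
      (auto simp: finite_exact_configs, auto simp: exact_configs_def dest: exact_period_unique)
  ultimately show ?thesis by (simp add: num_configs_def)
qed

lemma num_attractors_moebius:
  assumes "p \<ge> 1"
  shows "real (num_attractors l r p) =
    1 / real p * (\<Sum>q | q dvd p. of_int (moebius (p div q)) * real (num_configs l r q))"
proof -
  have "(\<Sum>q | q dvd p. of_int (moebius (p div q)) * real (num_configs l r q)) =
        (\<Sum>q | q dvd p. of_int (moebius (p div q)) *
           (\<Sum>d | d dvd q. real (card (exact_configs l r d))))"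
    using assms by (intro sum.cong refl)
      (auto simp: num_configs_eq_sum_exact Suc_le_eq dest: dvd_pos_nat)
  also have "\<dots> = real (card (exact_configs l r p))"
    using assms by (intro moebius_inversion) auto
  also have "\<dots> = real p * real (num_attractors l r p)"
    by (simp flip: num_attractors_mult_period)
  finally show ?thesis using assms by simp
qed

text \<open>Since \<open>r\<close> is a period of every periodic configuration, each exact period
  divides \<open>r\<close>. Attractors of different periods are distinct because the size of an
  orbit is its period.\<close>

lemma total_attractors_eq_sum:
  assumes "r \<ge> 1" and per: "\<And>p x. x \<in> configs l r \<Longrightarrow> has_period l r p x \<Longrightarrow> has_period l r r x"
  shows "total_attractors l r = (\<Sum>p | p dvd r. num_attractors l r p)"
proof -
  have empty: "attractors_of_period l r p = {}" if "\<not> p dvd r" for p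
  proof -
    have "\<not> has_exact_period l r p x" if "x \<in> configs l r" for x
      using per[OF that, of p] has_period_iff_dvd[of l r p x r] \<open>\<not> p dvd r\<close>
      by (auto simp: has_exact_period_def)
    then show ?thesis by (auto simp: attractors_of_period_eq exact_configs_def)
  qed
  have "(\<Union>p. attractors_of_period l r p) = (\<Union>p\<in>{p. p dvd r}. attractors_of_period l r p)"
    using empty by auto
  moreover have "card (\<Union>p\<in>{p. p dvd r}. attractors_of_period l r p) =
      (\<Sum>p\<in>{p. p dvd r}. card (attractors_of_period l r p))"
    using assms(1) by (intro card_UN_disjoint)
      (auto simp: attractors_of_period_eq finite_exact_configs, metis (no_types, lifting)
        card_orbit exact_configs_def mem_Collect_eq)
  ultimately show ?thesis by (simp add: total_attractors_def num_attractors_def)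
qed

text \<open>A configuration of exact period \<open>d\<close> is counted with the sum of
  \<open>totient\<close> over the divisors of \<open>r div d\<close>, that is, with weight
  \<open>r div d\<close>. The \<open>d\<close> configurations of one orbit therefore contribute
  \<open>r\<close> altogether.\<close>

lemma sum_totient_num_configs:
  assumes "r \<ge> 1"
  shows "(\<Sum>p | p dvd r. totient (r div p) * num_configs l r p) =
         r * (\<Sum>p | p dvd r. num_attractors l r p)"
proof -
  have "(\<Sum>p | p dvd r. totient (r div p) * num_configs l r p) =
        (\<Sum>p | p dvd r. totient (r div p) * (\<Sum>d | d dvd p. card (exact_configs l r d)))"
    using assms by (intro sum.cong refl)
      (auto simp: num_configs_eq_sum_exact Suc_le_eq dest: dvd_pos_nat)
  also have "\<dots> = (\<Sum>d | d dvd r. card (exact_configs l r d) * (r div d))"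
    using assms by (subst sum_divisors_convolution) (auto simp: totient_divisor_sum)
  also have "\<dots> = (\<Sum>d | d dvd r. r * num_attractors l r d)"
    by (intro sum.cong refl) (auto simp: num_attractors_mult_period[symmetric])
  finally show ?thesis by (simp add: sum_distrib_left)
qed

subsection \<open>Binary cycles without adjacent zeros\<close>

text \<open>The ends \<open>a\<close> and \<open>b\<close> take part in the adjacency condition but
  not in the length; equal ends let a path be closed to a cycle.\<close>

abbreviation or_paths :: "bool \<Rightarrow> nat \<Rightarrow> bool \<Rightarrow> bool list set" where
  "or_paths a n b \<equiv> {xs. length xs = n \<and> successively (\<or>) (a # xs @ [b])}"

lemma or_paths_Suc: "or_paths a (Suc n) b = (\<Union>c\<in>{c. a \<or> c}. (#) c ` or_paths c n b)"
proof (intro equalityI subsetI)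
  fix xs assume "xs \<in> or_paths a (Suc n) b"
  then show "xs \<in> (\<Union>c\<in>{c. a \<or> c}. (#) c ` or_paths c n b)"
    by (cases xs) auto
qed auto

lemma finite_or_paths: "finite (or_paths a n b)"
  by (rule finite_subset[OF _ finite_lists_length_eq[of "UNIV :: bool set" n]]) auto

lemma card_or_paths_Suc:
  "card (or_paths True (Suc n) b) = card (or_paths True n b) + card (or_paths False n b)"
  "card (or_paths False (Suc n) b) = card (or_paths True n b)"
proof -
  have *: "card (or_paths a (Suc n) b) = (\<Sum>c\<in>{c. a \<or> c}. card (or_paths c n b))" for a
    unfolding or_paths_Suc
    by (subst card_UN_disjoint) (auto simp: finite_or_paths card_image)
  have sets: "{c. True \<or> c} = {True, False}" "{c. False \<or> c} = {True}" by auto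
  show "card (or_paths True (Suc n) b) = card (or_paths True n b) + card (or_paths False n b)"
    "card (or_paths False (Suc n) b) = card (or_paths True n b)"
    using *[of True] *[of False] by (simp_all only: sets) simp_all
qed

lemma card_or_paths_0: "card (or_paths a 0 b) = (if a \<or> b then 1 else 0)"
proof -
  have "or_paths a 0 b = (if a \<or> b then {[]} else {})" by auto
  then show ?thesis by simp
qed

text \<open>Removing the first letter turns a left end \<open>False\<close> into
  \<open>True\<close>, and a left end \<open>True\<close> into either, so both left ends go through
  one induction. The count 0 for \<open>n = 0\<close> with both ends \<open>False\<close> matches
  \<open>fib 0 = 0\<close>.\<close>

lemma card_or_paths:
  "card (or_paths True n True) = fib (n + 2) \<and> card (or_paths False n True) = fib (n + 1) \<and>
   card (or_paths True n False) = fib (n + 1) \<and> card (or_paths False n False) = fib n"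
  by (induction n) (simp_all only: card_or_paths_Suc card_or_paths_0, simp_all)

text \<open>Periodic functions on the integers stand for words on a cycle, so that shifts need no
  reduction of indices. For \<open>m = 1\<close> a letter is its own neighbour and only the constant
  \<open>True\<close> remains.\<close>

abbreviation or_cycles :: "nat \<Rightarrow> (int \<Rightarrow> bool) set" where
  "or_cycles m \<equiv> {w. (\<forall>k. w (k + int m) = w k) \<and> (\<forall>k. w k \<or> w (k - 1))}"

lemma periodic_mult:
  fixes w :: "int \<Rightarrow> 'a"
  assumes "\<And>k. w (k + p) = w k"
  shows "w (k + p * j) = w k"
proof (induction j rule: int_induct[of _ 0])
  case (step1 i)
  then show ?case using assms[of "k + p * i"] by (simp add: algebra_simps)
next
  case (step2 i)
  then show ?case using assms[of "k + p * (i - 1)"] by (simp add: algebra_simps)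
qed simp

text \<open>With this, each later comparison of indices becomes a divisibility.\<close>

lemma periodic_cong:
  fixes w :: "int \<Rightarrow> 'a"
  assumes "\<And>k. w (k + p) = w k" and "p dvd j - k"
  shows "w j = w k"
proof -
  obtain i where "j - k = p * i" using assms(2) by blast
  then have "j = k + p * i" by simp
  then show ?thesis using periodic_mult[of w p, OF assms(1)] by simp
qed

text \<open>Cut the cycle at position 0. The letter there serves as both ends of a path with
  \<open>n\<close> inner letters, and the two choices of it give \<open>fib (n + 2)\<close> and
  \<open>fib n\<close>.\<close>

lemma card_or_cycles:
  "card (or_cycles (Suc n)) = fib (n + 2) + fib n"
proof -
  let ?P = "\<lambda>a. (#) a ` or_paths a n a"
  let ?f = "\<lambda>w::int \<Rightarrow> bool. map (\<lambda>i. w (int i)) [0..<Suc n]"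
  have "bij_betw ?f (or_cycles (Suc n)) (?P True \<union> ?P False)"
  proof (rule bij_betwI[where g = "\<lambda>xs t. xs ! nat (t mod int (Suc n))"])
    show "?f \<in> or_cycles (Suc n) \<rightarrow> ?P True \<union> ?P False"
    proof
      fix w assume w: "w \<in> or_cycles (Suc n)"
      have "successively (\<or>) (map (\<lambda>i. w (int i)) [0..<Suc (Suc n)])"
      proof (subst successively_conv_nth, intro allI impI)
        fix i assume "Suc i < length (map (\<lambda>i. w (int i)) [0..<Suc (Suc n)])"
        moreover have "w (int i + 1) \<or> w (int i + 1 - 1)" using w by blast
        then have "w (int i) \<or> w (int i + 1)" by auto
        ultimately show "map (\<lambda>i. w (int i)) [0..<Suc (Suc n)] ! i \<or>
            map (\<lambda>i. w (int i)) [0..<Suc (Suc n)] ! Suc i"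
          by (simp add: add.commute del: upt_Suc)
      qed
      \<comment> \<open>Position \<open>n + 1\<close> is position 0 again and supplies the closing
        end of the path.\<close>
      moreover have "w (1 + int n) = w 0" using w by (auto dest!: spec[of _ 0] simp: add.commute)
      then have "map (\<lambda>i. w (int i)) [0..<Suc (Suc n)] = ?f w @ [w 0]"
        by simp
      moreover have "?f w = w 0 # map (\<lambda>i. w (int i)) [1..<Suc n]"
        by (simp add: upt_conv_Cons del: upt_Suc)
      ultimately have "?f w \<in> ?P (w 0)" by (simp del: upt_Suc)
      then show "?f w \<in> ?P True \<union> ?P False" by (cases "w 0") auto
    qed
  next
    show "(\<lambda>xs t. xs ! nat (t mod int (Suc n))) \<in> ?P True \<union> ?P False \<rightarrow> or_cycles (Suc n)"
    proof
      fix xs assume "xs \<in> ?P True \<union> ?P False"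
      then obtain a ys where xs: "xs = a # ys" "length ys = n" "successively (\<or>) (xs @ [a])"
        by auto
      have len: "length xs = Suc n" and xs0: "xs ! 0 = a" using xs by auto
      have "xs ! nat (k mod int (Suc n)) \<or> xs ! nat ((k - 1) mod int (Suc n))" for k
      proof -
        define i where "i = nat ((k - 1) mod int (Suc n))"
        have i: "i < Suc n" by (simp add: i_def nat_less_iff)
        have "k mod int (Suc n) = ((k - 1) mod int (Suc n) + 1) mod int (Suc n)"
          by (simp add: mod_simps)
        then have k: "nat (k mod int (Suc n)) = Suc i mod Suc n"
          by (simp add: i_def nat_mod_distrib nat_add_distrib flip: zmod_int)
        have "(xs @ [a]) ! i \<or> (xs @ [a]) ! Suc i"
          using xs i by (auto simp: successively_conv_nth)
        \<comment> \<open>For \<open>i = n\<close> the right neighbour is the appended letter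
          \<open>a\<close>, which is also \<open>xs ! 0\<close>.\<close>
        then have "xs ! i \<or> xs ! (Suc i mod Suc n)"
          using len xs0 i by (cases "Suc i = Suc n") (auto simp: nth_append)
        then show ?thesis unfolding k by (auto simp: i_def)
      qed
      then show "(\<lambda>t. xs ! nat (t mod int (Suc n))) \<in> or_cycles (Suc n)" by simp
    qed
  next
    fix w assume w: "w \<in> or_cycles (Suc n)"
    show "(\<lambda>t. ?f w ! nat (t mod int (Suc n))) = w"
    proof
      fix t
      have "nat (t mod int (Suc n)) < Suc n" by (simp add: nat_less_iff)
      then have "?f w ! nat (t mod int (Suc n)) = w (t mod int (Suc n))"
        by (simp del: upt_Suc)
      also have "\<dots> = w t"
      proof (rule periodic_cong[where p = "int (Suc n)"])
        show "int (Suc n) dvd t mod int (Suc n) - t"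
          by (simp only: mod_eq_dvd_iff[symmetric] mod_mod_trivial)
      qed (use w in blast)
      finally show "?f w ! nat (t mod int (Suc n)) = w t" .
    qed
  next
    fix xs assume "xs \<in> ?P True \<union> ?P False"
    then have "length xs = Suc n" by auto
    then show "?f (\<lambda>t. xs ! nat (t mod int (Suc n))) = xs"
      by (intro nth_equalityI) (auto simp del: upt_Suc simp flip: zmod_int)
  qed
  then have "card (or_cycles (Suc n)) = card (?P True \<union> ?P False)"
    by (rule bij_betw_same_card)
  also have "\<dots> = card (?P True) + card (?P False)"
    by (rule card_Un_disjoint) (auto simp: finite_or_paths)
  also have "\<dots> = fib (n + 2) + fib n"
    using card_or_paths[of n] by (simp add: card_image)
  finally show ?thesis .
qed

section \<open>Lucas numbers in terms of the golden ratio\<close>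

lemma phi_conj_abs: "\<bar>phi_conj\<bar> = - phi_conj"
  by (simp add: phi_conj_def field_simps)

lemma phi_mult_phi_conj: "phi * phi_conj = - 1"
  by (simp add: phi_def phi_conj_def field_simps)

text \<open>Both sides obey the Fibonacci recurrence, as \<open>phi\<close> and
  \<open>phi_conj\<close> are the roots of x^2 = x + 1.\<close>

lemma fib_lucas: "real (fib (n + 2) + fib n) = phi ^ Suc n + phi_conj ^ Suc n"
proof (induction n rule: fib.induct)
  case (3 n)
  have "phi\<^sup>2 = phi + 1" "phi_conj\<^sup>2 = phi_conj + 1"
    by (simp_all add: phi_def phi_conj_def power2_eq_square field_simps)
  then have "phi ^ Suc n * phi\<^sup>2 = phi ^ Suc n * (phi + 1)"
    "phi_conj ^ Suc n * phi_conj\<^sup>2 = phi_conj ^ Suc n * (phi_conj + 1)"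
    by simp_all
  then have "phi ^ Suc (Suc (Suc n)) = phi ^ Suc (Suc n) + phi ^ Suc n"
    "phi_conj ^ Suc (Suc (Suc n)) = phi_conj ^ Suc (Suc n) + phi_conj ^ Suc n"
    by (simp_all only: power2_eq_square distrib_left power_Suc) (simp_all add: mult_ac)
  with 3 show ?case by simp
qed (simp_all add: phi_def phi_conj_def power2_eq_square field_simps eval_nat_numeral)

text \<open>From \<open>phi * phi_conj = - 1\<close> one gets
  \<open>\<bar>phi_conj\<bar> * phi\<^sup>2 = phi\<close>, so the factor in front turns the power of
  \<open>phi\<^sup>2\<close> into \<open>phi ^ m\<close>. The sign of \<open>phi_conj ^ m\<close>
  depends on the parity of \<open>m\<close>, whence the two cases.\<close>

lemma card_or_cycles_phi:
  assumes "m \<ge> 1"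
  shows "real (card (or_cycles m)) =
    (if odd m then \<bar>phi_conj\<bar> ^ m * ((phi\<^sup>2) ^ m - 1) else \<bar>phi_conj\<bar> ^ m * ((phi\<^sup>2) ^ m + 1))"
proof -
  obtain n where n: "m = Suc n" using assms by (cases m) auto
  have "real (card (or_cycles m)) = phi ^ m + phi_conj ^ m"
    unfolding n card_or_cycles by (rule fib_lucas)
  moreover have "\<bar>phi_conj\<bar> ^ m * (phi\<^sup>2) ^ m = phi ^ m"
  proof -
    have "\<bar>phi_conj\<bar> * phi\<^sup>2 = phi"
      using phi_mult_phi_conj unfolding phi_conj_abs power2_eq_square
      by (metis minus_mult_left minus_minus mult.assoc mult.commute mult_1)
    then show ?thesis by (metis power_mult_distrib)
  qed
  moreover have "\<bar>phi_conj\<bar> ^ m = (if odd m then - (phi_conj ^ m) else phi_conj ^ m)"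
    by (simp add: phi_conj_abs)
  ultimately show ?thesis by (auto simp: right_diff_distrib distrib_left)
qed

section \<open>Splitting the residues modulo \<open>p\<close> into cycles of steps of length
  \<open>l\<close>\<close>

abbreviation or_circulant :: "nat \<Rightarrow> nat \<Rightarrow> (int \<Rightarrow> bool) set" where
  "or_circulant l p \<equiv> {u. (\<forall>t. u (t + int p) = u t) \<and> (\<forall>t. u t \<or> u (t - int l))}"

text \<open>Each residue \<open>j\<close> modulo \<open>D\<close> carries one cycle, visited by
  \<open>j + k * l\<close>. The constraint never links two cycles, so the words on them are chosen
  independently.\<close>

lemma card_or_circulant:
  assumes "p \<ge> 1"
  shows "card (or_circulant l p) = card (or_cycles (p div gcd l p)) ^ gcd l p"
proof -
  define D where "D = gcd l p"
  define m where "m = p div D"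
  define s where "s = l div D"
  have D: "D \<ge> 1" using assms by (simp add: D_def Suc_le_eq)
  have pm: "p = D * m" and ls: "l = D * s" by (simp_all add: D_def m_def s_def)
  obtain a b where ab: "a * int l + b * int p = int D"
    using bezout_int[of "int l" "int p"] by (auto simp: D_def)
  have "int D * (a * int s + b * int m) = int D * 1"
    using ab by (simp add: pm ls algebra_simps)
  then have ab1: "a * int s + b * int m = 1" using D by simp
  let ?f = "\<lambda>u. \<lambda>j\<in>{..<D}. \<lambda>k. u (int j + k * int l) :: bool"
  \<comment> \<open>By Bezout \<open>a\<close> inverts \<open>s\<close> modulo \<open>m\<close>, and
    \<open>t\<close> is congruent to \<open>t mod D + a * (t div D) * l\<close> modulo
    \<open>p\<close>. Thus \<open>a * (t div D)\<close> is the position of \<open>t\<close> in its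
    cycle.\<close>
  let ?g = "\<lambda>w t. w (nat (t mod int D)) (a * (t div int D)) :: bool"
  have "bij_betw ?f (or_circulant l p) ({..<D} \<rightarrow>\<^sub>E or_cycles m)"
  proof (rule bij_betwI[where g = ?g])
    show "?f \<in> or_circulant l p \<rightarrow> ({..<D} \<rightarrow>\<^sub>E or_cycles m)"
    proof (intro Pi_I PiE_I)
      fix u j assume u: "u \<in> or_circulant l p" and j: "j \<in> {..<D}"
      have "u (int j + (k + int m) * int l) = u (int j + k * int l)" for k
      proof (rule periodic_cong[where p = "int p"])
        have "int j + (k + int m) * int l - (int j + k * int l) = int p * int s"
          by (simp add: pm ls algebra_simps)
        then show "int p dvd int j + (k + int m) * int l - (int j + k * int l)" by simp
      qed (use u in blast)
      moreover have "u (int j + k * int l) \<or> u (int j + (k - 1) * int l)" for k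
      proof -
        have "u (int j + k * int l) \<or> u (int j + k * int l - int l)" using u by blast
        then show ?thesis by (simp add: algebra_simps)
      qed
      ultimately show "?f u j \<in> or_cycles m" using j by simp
    qed simp
  next
    show "?g \<in> ({..<D} \<rightarrow>\<^sub>E or_cycles m) \<rightarrow> or_circulant l p"
    proof
      fix w assume w: "w \<in> {..<D} \<rightarrow>\<^sub>E or_cycles m"
      have wj: "w (nat (t mod int D)) \<in> or_cycles m" for t
        using w D by (intro PiE_mem[of w]) (auto simp: nat_less_iff)
      have "?g w (t + int p) = ?g w t" for t
      proof -
        have "w (nat (t mod int D)) (a * (t div int D + int m)) = ?g w t"
        proof (rule periodic_cong[where p = "int m"])
          show "int m dvd a * (t div int D + int m) - a * (t div int D)"
            by (simp add: algebra_simps)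
        qed (use wj[of t] in blast)
        then show ?thesis using D by (simp add: pm add.commute)
      qed
      moreover have "?g w t \<or> ?g w (t - int l)" for t
      proof -
        have "t - int l = t + int D * (- int s)" by (simp add: ls)
        then have "(t - int l) mod int D = t mod int D" "(t - int l) div int D = t div int D - int s"
          using D mod_mult_self2[of t "int D" "- int s"] div_mult_self2[of "int D" t "- int s"]
          by simp_all
        \<comment> \<open>Subtracting \<open>l\<close> keeps the residue modulo \<open>D\<close> and
          lowers the quotient by \<open>s\<close>; since \<open>a * s\<close> is 1 modulo
          \<open>m\<close>, the position in the cycle drops by one.\<close>
        moreover have "w (nat (t mod int D)) (a * (t div int D - int s)) =
            w (nat (t mod int D)) (a * (t div int D) - 1)"
        proof (rule periodic_cong[where p = "int m"])
          have "a * (t div int D - int s) - (a * (t div int D) - 1) = 1 - a * int s"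
            by (simp add: algebra_simps)
          also have "\<dots> = b * int m" using ab1 by linarith
          finally show "int m dvd a * (t div int D - int s) - (a * (t div int D) - 1)" by simp
        qed (use wj[of t] in blast)
        moreover have "?g w t \<or> w (nat (t mod int D)) (a * (t div int D) - 1)"
          using wj[of t] by blast
        ultimately show ?thesis by simp
      qed
      ultimately show "?g w \<in> or_circulant l p" by blast
    qed
  next
    fix u assume u: "u \<in> or_circulant l p"
    show "?g (?f u) = u"
    proof
      fix t
      have "?g (?f u) t = u (t mod int D + a * (t div int D) * int l)"
        using D by (simp add: nat_less_iff)
      also have "\<dots> = u t"
      proof (rule periodic_cong[where p = "int p"])
        have "t mod int D + a * (t div int D) * int l - t =
            t mod int D + (t div int D) * (int D - b * int p) - t"
        proof -
          have "a * (t div int D) * int l = (t div int D) * (a * int l)" by (simp add: mult_ac)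
          moreover have "a * int l = int D - b * int p" using ab by simp
          ultimately show ?thesis by simp
        qed
        also have "\<dots> = int p * (- b * (t div int D))"
          using div_mult_mod_eq[of t "int D"] by (simp add: algebra_simps)
        finally show "int p dvd t mod int D + a * (t div int D) * int l - t" by simp
      qed (use u in blast)
      finally show "?g (?f u) t = u t" .
    qed
  next
    fix w assume w: "w \<in> {..<D} \<rightarrow>\<^sub>E or_cycles m"
    show "?f (?g w) = w"
    proof (rule extensionalityI[of _ "{..<D}"])
      show "w \<in> extensional {..<D}" using w by (simp add: PiE_def)
    next
      fix j assume j: "j \<in> {..<D}"
      have wj: "w j \<in> or_cycles m" using w j by (rule PiE_mem)
      show "?f (?g w) j = w j"
      proof
        fix k
        have eq: "int j + k * int l = int j + int D * (k * int s)" by (simp add: ls)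
        have "(int j + k * int l) mod int D = int j" "(int j + k * int l) div int D = k * int s"
          using j D mod_mult_self2[of "int j" "int D" "k * int s"]
            div_mult_self2[of "int D" "int j" "k * int s"]
          unfolding eq by simp_all
        then have "?f (?g w) j k = w j (a * (k * int s))" using j by simp
        also have "\<dots> = w j k"
        proof (rule periodic_cong[where p = "int m"])
          have "a * (k * int s) - k = k * (a * int s - 1)" by (simp add: algebra_simps)
          also have "a * int s - 1 = - b * int m" using ab1 by simp
          finally show "int m dvd a * (k * int s) - k" by simp
        qed (use wj in blast)
        finally show "?f (?g w) j k = w j k" .
      qed
    qed (rule restrict_extensional)
  qed
  then have "card (or_circulant l p) = card ({..<D} \<rightarrow>\<^sub>E or_cycles m)"
    by (rule bij_betw_same_card)
  also have "\<dots> = card (or_cycles m) ^ D" by (simp add: card_PiE)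
  finally show ?thesis by (simp add: m_def D_def)
qed

subsection \<open>Periodic configurations as traces of node 0\<close>

text \<open>Node \<open>i\<close> shows at time \<open>t\<close> the state that node 0 had \<open>delay l i\<close> steps earlier. So a
  trajectory is determined by the trace of node 0, and is indexed by all integers when
  periodic.\<close>

definition delay :: "nat \<Rightarrow> nat \<Rightarrow> nat" where
  "delay l i = (if i < l then i else i - l + 1)"

definition window :: "nat \<Rightarrow> nat \<Rightarrow> (int \<Rightarrow> bool) \<Rightarrow> int \<Rightarrow> bool list" where
  "window l r u t = map (\<lambda>i. u (t - int (delay l i))) [0..<l + r - 1]"

text \<open>Node 0 reads the last nodes of the two circuits, whose delays are \<open>l - 1\<close>
  and \<open>r - 1\<close>; the update itself adds one step.\<close>

abbreviation traces :: "nat \<Rightarrow> nat \<Rightarrow> (int \<Rightarrow> bool) set" where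
  "traces l r \<equiv> {u. \<forall>t. u t \<longleftrightarrow> \<not> u (t - int l) \<or> u (t - int r)}"

lemma length_window: "length (window l r u t) = l + r - 1"
  by (simp add: window_def)

lemma nth_window: "i < l + r - 1 \<Longrightarrow> window l r u t ! i = u (t - int (delay l i))"
  by (simp add: window_def)

lemma window_periodic:
  assumes "\<And>t. u (t + p) = u t"
  shows "window l r u (t + p) = window l r u t"
proof -
  have "u (t + p - d) = u (t - d)" for d
    using assms[of "t - d"] by (simp add: algebra_simps)
  then show ?thesis by (simp add: window_def)
qed

context
  fixes l r :: nat
  assumes l: "l \<ge> 1" and r: "r \<ge> 1"
begin

lemma nth_window_0: "window l r u t ! 0 = u t"
  using l r by (simp add: nth_window delay_def)

lemma nth_F:
  assumes "x \<in> configs l r" "i < l + r - 1"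
  shows "F l r x ! i =
    (if i = 0 then \<not> x ! (l - 1) \<or> x ! (if r = 1 then 0 else l + r - 2)
     else if i = l then x ! 0 else x ! (i - 1))"
proof -
  have len: "length x = l + r - 1" using assms by (simp add: configs_def)
  have "x \<noteq> []" using l r len by auto
  then have "last (left_part l x) = x ! (l - 1)"
    using l r len by (simp add: left_part_def last_conv_nth)
  \<comment> \<open>For \<open>r = 1\<close> the list \<open>drop l x\<close> is empty, and the last
    entry is that of node 0.\<close>
  moreover have "last (right_part l x) = x ! (if r = 1 then 0 else l + r - 2)"
    using l r len by (simp add: right_part_def last_conv_nth numeral_2_eq_2)
  ultimately show ?thesis using assms(2) by (simp add: F_def)
qed

lemma window_in_configs: "window l r u t \<in> configs l r"
  by (simp add: configs_def length_window)

lemma F_window: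
  assumes "u \<in> traces l r"
  shows "F l r (window l r u t) = window l r u (t + 1)"
proof (rule nth_equalityI)
  show "length (F l r (window l r u t)) = length (window l r u (t + 1))"
    by (simp add: F_def length_window)
  fix i assume "i < length (F l r (window l r u t))"
  then have i: "i < l + r - 1" by (simp add: F_def)
  have u: "u (t + 1) \<longleftrightarrow> \<not> u (t + 1 - int l) \<or> u (t + 1 - int r)" using assms by blast
  have last_left: "window l r u t ! (l - 1) = u (t + 1 - int l)"
    using l r by (simp add: nth_window delay_def of_nat_diff algebra_simps)
  have last_right: "window l r u t ! (if r = 1 then 0 else l + r - 2) = u (t + 1 - int r)"
    using l r by (auto simp: nth_window nth_window_0 delay_def of_nat_diff algebra_simps)
  show "F l r (window l r u t) ! i = window l r u (t + 1) ! i"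
  proof (cases "i = 0")
    case True
    have "0 < l + r - 1" using l r by simp
    then have "F l r (window l r u t) ! 0 \<longleftrightarrow> u (t + 1)"
      by (simp only: nth_F[OF window_in_configs] last_left last_right u simp_thms if_True)
    then show ?thesis by (simp only: True nth_window_0)
  next
    case False
    then show ?thesis using i l
      by (auto simp: nth_F[OF window_in_configs i] nth_window_0 nth_window delay_def of_nat_diff
          intro!: arg_cong[of _ _ u])
  qed
qed

lemma funpow_F_window:
  assumes "u \<in> traces l r"
  shows "(F l r ^^ n) (window l r u t) = window l r u (t + int n)"
proof (induction n)
  case (Suc n)
  then show ?case using F_window[OF assms, of "t + int n"] by (simp add: add_ac)
qed simp

text \<open>The trajectory is indexed by all integers, so the state of any node can be traced back
  to node 0 without reaching an initial time.\<close>

lemma window_of_trajectory: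
  assumes "\<And>t::int. X t \<in> configs l r" "\<And>t. X (t + 1) = F l r (X t)"
  defines "u \<equiv> \<lambda>t. X t ! 0"
  shows "X t = window l r u t" and "u \<in> traces l r"
proof -
  have step: "X t = F l r (X (t - 1))" for t using assms(2)[of "t - 1"] by simp
  \<comment> \<open>Each induction step goes one time unit back, hence the arbitrary
    \<open>t\<close>. Node \<open>l\<close> reads node 0 directly, where the delay restarts at
    1.\<close>
  have nth: "X t ! i = u (t - int (delay l i))" if "i < l + r - 1" for t i
    using that
  proof (induction i arbitrary: t)
    case 0
    then show ?case using l by (simp add: u_def delay_def)
  next
    case (Suc i)
    have "X t ! Suc i = (if Suc i = l then X (t - 1) ! 0 else X (t - 1) ! i)"
      by (subst step) (simp add: nth_F[OF assms(1) Suc.prems])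
    also have "\<dots> = u (t - int (delay l (Suc i)))"
      using Suc.IH[of "t - 1"] Suc.prems by (auto simp: u_def delay_def of_nat_diff algebra_simps)
    finally show ?case .
  qed
  then show win: "X t = window l r u t" for t
    using assms(1)[of t] by (intro nth_equalityI) (simp_all add: configs_def nth_window length_window)
  have "u t \<longleftrightarrow> \<not> u (t - int l) \<or> u (t - int r)" for t
  proof -
    have "u t \<longleftrightarrow> F l r (X (t - 1)) ! 0" unfolding u_def by (subst step) (rule refl)
    also have "\<dots> \<longleftrightarrow> \<not> X (t - 1) ! (l - 1) \<or> X (t - 1) ! (if r = 1 then 0 else l + r - 2)"
      using l r by (subst nth_F[OF assms(1)]) auto
    also have "X (t - 1) ! (l - 1) = u (t - int l)"
      using l r by (simp add: nth delay_def of_nat_diff)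
    also have "X (t - 1) ! (if r = 1 then 0 else l + r - 2) = u (t - int r)"
      using l r by (auto simp: nth delay_def of_nat_diff)
    finally show ?thesis .
  qed
  then show "u \<in> traces l r" by blast
qed

lemma periodic_config_eq_window:
  assumes "x \<in> configs l r" "has_period l r p x"
  obtains u where "u \<in> traces l r" "\<And>t. u (t + int p) = u t" "x = window l r u 0"
proof -
  have p: "p \<ge> 1" "(F l r ^^ p) x = x" using assms(2) by (auto simp: has_period_def)
  \<comment> \<open>Reading time modulo \<open>p\<close> extends the forward orbit to negative
    times.\<close>
  define X where "X t = (F l r ^^ nat (t mod int p)) x" for t
  have Xin: "X t \<in> configs l r" for t by (simp add: X_def assms(1) funpow_F_in_configs)
  have step: "X (t + 1) = F l r (X t)" for t
  proof -
    have "(t + 1) mod int p = (t mod int p + 1) mod int p" by (simp add: mod_simps)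
    then have "nat ((t + 1) mod int p) = Suc (nat (t mod int p)) mod p"
      using p(1) by (simp add: nat_mod_distrib nat_add_distrib)
    then show ?thesis using funpow_mod_eq[OF p(2)] by (simp add: X_def)
  qed
  show ?thesis
  proof (rule that[of "\<lambda>t. X t ! 0"])
    show "(\<lambda>t. X t ! 0) \<in> traces l r" by (rule window_of_trajectory(2)[of X, OF Xin step])
    show "X (t + int p) ! 0 = X t ! 0" for t by (simp add: X_def)
    show "x = window l r (\<lambda>t. X t ! 0) 0"
      using window_of_trajectory(1)[of X, OF Xin step, of 0] by (simp add: X_def)
  qed
qed

lemma periodic_trace:
  assumes "u \<in> traces l r" "\<And>t. u (t + int p) = u t" "p \<ge> 1"
  shows "u (t + int r) = u t"
proof -
  have mono: "u t \<Longrightarrow> u (t + int r * int k)" for t k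
  proof (induction k)
    case (Suc k)
    have "u (t + int r * int (Suc k)) \<longleftrightarrow> \<not> u (t + int r * int (Suc k) - int l)
        \<or> u (t + int r * int (Suc k) - int r)"
      using assms(1) by blast
    with Suc show ?case by (simp add: algebra_simps)
  qed simp
  have "u t" if "u (t + int r)"
  proof -
    \<comment> \<open>Truth propagates forward in steps of \<open>r\<close>. From
      \<open>t + r\<close>, another \<open>p - 1\<close> steps lead to \<open>t + p * r\<close>,
      where \<open>u\<close> has the same value as at \<open>t\<close>.\<close>
    have "u (t + int r + int r * int (p - 1))" using mono that by blast
    also have "t + int r + int r * int (p - 1) = t + int p * int r"
      using assms(3) by (simp add: of_nat_diff algebra_simps)
    finally show ?thesis using periodic_mult[of u "int p", OF assms(2)] by simp
  qed
  moreover have "u (t + int r)" if "u t" using mono[OF that, of 1] by simp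
  ultimately show ?thesis by blast
qed

section \<open>Numbers of periodic configurations and of attractors\<close>

lemma has_period_r:
  assumes "x \<in> configs l r" "has_period l r p x"
  shows "has_period l r r x"
proof -
  obtain u where u: "u \<in> traces l r" "\<And>t. u (t + int p) = u t" "x = window l r u 0"
    by (rule periodic_config_eq_window[OF assms]) rule
  have "p \<ge> 1" using assms(2) by (simp add: has_period_def)
  then have per: "u (t + int r) = u t" for t by (rule periodic_trace[where u = u and p = p, OF u(1,2)])
  have "window l r u (0 + int r) = window l r u 0"
    using per by (rule window_periodic)
  then show ?thesis using r by (simp add: has_period_def u(3) funpow_F_window[OF u(1)])
qed

lemma num_configs_eq_card_or_circulant:
  assumes "p dvd r"
  shows "num_configs l r p = card (or_circulant l p)"
proof -
  have p: "p \<ge> 1" using assms r by (cases p) auto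
  \<comment> \<open>As \<open>p\<close> divides \<open>r\<close>, the term \<open>u (t - r)\<close>
    equals \<open>u t\<close>, and the trace equation is then equivalent to
    \<open>u t \<or> u (t - l)\<close>.\<close>
  have trace: "u \<in> traces l r" if "u \<in> or_circulant l p" for u
  proof -
    have "u (t - int r) = u t" for t
    proof (rule periodic_cong[where p = "int p"])
      show "int p dvd t - int r - t" using assms by simp
    qed (use that in blast)
    then show ?thesis using that by blast
  qed
  have "bij_betw (\<lambda>u. window l r u 0) (or_circulant l p)
      {x \<in> configs l r. has_period l r p x}"
    unfolding bij_betw_def
  proof (intro conjI inj_onI equalityI subsetI)
    fix u v assume uv: "u \<in> or_circulant l p" "v \<in> or_circulant l p"
      and eq: "window l r u 0 = window l r v 0"
    \<comment> \<open>Equal windows stay equal under \<open>F\<close>, and their entry 0 shows the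
      trace at all times from 0 on; periodicity gives the rest.\<close>
    have nonneg: "u (int n) = v (int n)" for n
    proof -
      have "window l r u (int n) = window l r v (int n)"
        using funpow_F_window[OF trace[OF uv(1)], of n 0]
          funpow_F_window[OF trace[OF uv(2)], of n 0] eq by simp
      then show ?thesis by (metis nth_window_0)
    qed
    show "u = v"
    proof
      fix t
      have *: "w t = w (t mod int p)" if "w \<in> or_circulant l p" for w
      proof (rule periodic_cong[where p = "int p"])
        show "int p dvd t - t mod int p" by simp
      qed (use that in blast)
      show "u t = v t"
        using *[OF uv(1)] *[OF uv(2)] nonneg[of "nat (t mod int p)"] p by simp
    qed
  next
    fix x assume "x \<in> (\<lambda>u. window l r u 0) ` or_circulant l p"
    then obtain u where u: "u \<in> or_circulant l p" "x = window l r u 0" by blast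
    have per: "u (t + int p) = u t" for t using u(1) by blast
    have "window l r u (0 + int p) = window l r u 0"
      using per by (rule window_periodic)
    then show "x \<in> {x \<in> configs l r. has_period l r p x}"
      using p by (simp add: has_period_def u(2) funpow_F_window[OF trace[OF u(1)]] window_in_configs)
  next
    fix x assume "x \<in> {x \<in> configs l r. has_period l r p x}"
    then have x: "x \<in> configs l r" "has_period l r p x" by simp_all
    obtain u where u: "u \<in> traces l r" "\<And>t. u (t + int p) = u t" "x = window l r u 0"
      by (rule periodic_config_eq_window[OF x]) rule
    have "u t \<or> u (t - int l)" for t
    proof -
      have "u (t - int r + int r) = u (t - int r)" by (rule periodic_trace[where u = u and p = p, OF u(1,2) p])
      moreover have "u t \<longleftrightarrow> \<not> u (t - int l) \<or> u (t - int r)" using u(1) by blast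
      ultimately show ?thesis by auto
    qed
    then have "u \<in> or_circulant l p" using u(2) by blast
    then show "x \<in> (\<lambda>u. window l r u 0) ` or_circulant l p" using u(3) by blast
  qed
  then show ?thesis by (simp only: num_configs_def bij_betw_same_card)
qed

lemma num_configs_eq_card_or_cycles:
  assumes "p dvd r"
  shows "num_configs l r p = card (or_cycles (p div gcd l p)) ^ gcd l p"
proof -
  have "p \<ge> 1" using assms r by (cases p) auto
  then show ?thesis using num_configs_eq_card_or_circulant[OF assms] card_or_circulant by simp
qed

lemma num_configs_phi:
  assumes "p dvd r"
  shows "real (num_configs l r p) =
    (if odd (p div gcd l p)
     then \<bar>phi_conj\<bar> ^ p * ((phi\<^sup>2) ^ (p div gcd l p) - 1) ^ gcd l p
     else \<bar>phi_conj\<bar> ^ p * ((phi\<^sup>2) ^ (p div gcd l p) + 1) ^ gcd l p)"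
proof -
  let ?m = "p div gcd l p"
  have "p > 0" using assms r by (cases p) auto
  then have m: "?m \<ge> 1" by (simp add: Suc_le_eq div_greater_zero_iff dvd_imp_le)
  have "\<bar>phi_conj\<bar> ^ p = (\<bar>phi_conj\<bar> ^ ?m) ^ gcd l p"
    by (simp flip: power_mult)
  then show ?thesis
    by (simp add: num_configs_eq_card_or_cycles[OF assms] card_or_cycles_phi[OF m] power_mult_distrib)
qed

lemma card_periodic_configs: "card (periodic_configs l r) = num_configs l r r"
proof -
  have "periodic_configs l r = {x \<in> configs l r. has_period l r r x}"
    using has_period_r by (auto simp: periodic_configs_def)
  then show ?thesis by (simp add: num_configs_def)
qed

lemma total_attractors_totient:
  "real (total_attractors l r) =
     1 / real r * (\<Sum>p | p dvd r. real (totient (r div p)) * real (num_configs l r p))"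
proof -
  have "r * total_attractors l r = (\<Sum>p | p dvd r. totient (r div p) * num_configs l r p)"
    using total_attractors_eq_sum[OF r has_period_r] sum_totient_num_configs[OF r] by simp
  then have "real r * real (total_attractors l r) =
      (\<Sum>p | p dvd r. real (totient (r div p)) * real (num_configs l r p))"
    by (simp flip: of_nat_mult of_nat_sum)
  then show ?thesis using r by (simp add: field_simps)
qed

end

text \<open>For \<open>q\<close> dividing \<open>p\<close>, \<open>gcd l q\<close> is determined by
  \<open>gcd l p\<close>, so the two Moebius sums agree term by term.\<close>

lemma num_attractors_cong:
  assumes "l \<ge> 1" "r \<ge> 1" "p dvd r" "l' \<ge> 1" "r' \<ge> 1" "p dvd r'" "gcd l' p = gcd l p"
  shows "num_attractors l' r' p = num_attractors l r p"
proof -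
  have p: "p \<ge> 1" using assms by (cases p) auto
  have "num_configs l' r' q = num_configs l r q" if "q dvd p" for q
  proof -
    have "gcd l' q = gcd (gcd l' p) q" "gcd l q = gcd (gcd l p) q"
      using that by (simp_all add: gcd.assoc gcd_proj2_if_dvd)
    then have "gcd l' q = gcd l q" using assms by simp
    moreover have "q dvd r" "q dvd r'" using that assms dvd_trans by blast+
    ultimately show ?thesis using assms by (simp add: num_configs_eq_card_or_cycles)
  qed
  then have "real (num_attractors l' r' p) = real (num_attractors l r p)"
    using p by (simp add: num_attractors_moebius)
  then show ?thesis by simp
qed

theorem proposition4:
  fixes l r :: nat
  assumes "l \<ge> 1" and "r \<ge> 1"
  shows
    "(\<forall>p. p dvd r \<and> \<not> p dvd l \<longrightarrow>
        real (num_configs l r p) =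
          (if odd (p div gcd l p)
           then \<bar>phi_conj\<bar> ^ p * ((phi\<^sup>2) ^ (p div gcd l p) - 1) ^ gcd l p
           else \<bar>phi_conj\<bar> ^ p * ((phi\<^sup>2) ^ (p div gcd l p) + 1) ^ gcd l p)) \<and>
     card (periodic_configs l r) = num_configs l r r \<and>
     (\<forall>p. p dvd r \<and> \<not> p dvd l \<longrightarrow>
        real (num_attractors l r p) =
          1 / real p * (\<Sum>q | q dvd p. of_int (moebius (p div q)) * real (num_configs l r q))) \<and>
     (\<forall>p l' r'. p dvd r \<and> \<not> p dvd l \<and>
        l' \<ge> 1 \<and> r' \<ge> 1 \<and> p dvd r' \<and> \<not> p dvd l' \<and> gcd l' p = gcd l p \<longrightarrow>
        num_attractors l' r' p = num_attractors l r p) \<and>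
     real (total_attractors l r) =
       1 / real r * (\<Sum>p | p dvd r. real (totient (r div p)) * real (num_configs l r p))"
proof (intro conjI allI impI)
  fix p assume "p dvd r \<and> \<not> p dvd l"
  then have p: "p dvd r" "p \<ge> 1" using assms by (auto simp: Suc_le_eq dest: dvd_pos_nat)
  show "real (num_configs l r p) =
      (if odd (p div gcd l p)
       then \<bar>phi_conj\<bar> ^ p * ((phi\<^sup>2) ^ (p div gcd l p) - 1) ^ gcd l p
       else \<bar>phi_conj\<bar> ^ p * ((phi\<^sup>2) ^ (p div gcd l p) + 1) ^ gcd l p)"
    using assms p(1) by (rule num_configs_phi)
  show "real (num_attractors l r p) =
      1 / real p * (\<Sum>q | q dvd p. of_int (moebius (p div q)) * real (num_configs l r q))"
    using p(2) by (rule num_attractors_moebius)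
next
  fix p l' r'
  assume "p dvd r \<and> \<not> p dvd l \<and>
    l' \<ge> 1 \<and> r' \<ge> 1 \<and> p dvd r' \<and> \<not> p dvd l' \<and> gcd l' p = gcd l p"
  then show "num_attractors l' r' p = num_attractors l r p"
    using assms num_attractors_cong by blast
qed (use assms in \<open>simp_all only: card_periodic_configs total_attractors_totient\<close>)

end
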